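(* Let $E=(e_{i,j})_{n\times n}\in MDS_n(\mathbb{R}_{\max})$. Then $E$ is a max-extreme point of the set $MDS_n(\mathbb{R}_{\max})$ if and only if $E$ is a $(0,1)$-matrix and there is at most one position $(i,j)$ with $e_{i,j}=1$ such that $E$ remains a max-doubly stochastic matrix after changing the entry $e_{i,j}$ to a number $r$ with $0\le r<1$.
   Context: Max algebra: $\mathbb{R}_{\max}$ denotes the semiring $(\mathbb{R}_{\ge 0},\oplus,\otimes)$ with $a\oplus b=\max(a,b)$ and $a\otimes b=ab$. $M_n(\mathbb{R}_{\max})$ is the set of $n\times n$ matrices with entries in $\mathbb{R}_{\ge 0}$. Addition $\oplus$ of matrices is entrywise maximum, scalars act by entrywise multiplication, and $(A\otimes B)_{i,j}=\max_k a_{i,k}b_{k,j}$. Let $\mathbf{1}=(1,\dots,1)^T$ (length $n$). A matrix $D\in M_n(\mathbb{R}_{\max})$ is max-doubly stochastic if $D\otimes\mathbf{1}=\mathbf{1}$ and $\mathbf{1}^T\otimes D=\mathbf{1}^T$; $MDS_n(\mathbb{R}_{\max})$ is the set of all such matrices. A set $S\subseteq M_n(\mathbb{R}_{\max})$ is max-convex if $\alpha_1s_1\oplus\alpha_2s_2\in S$ for all $s_1,s_2\in S$ and $\alpha_1,\alpha_2\in\mathbb{R}_{\max}$ with $\alpha_1\oplus\alpha_2=1$. The set $MDS_n(\mathbb{R}_{\max})$ is max-convex. An element $s$ of a max-convex set $S$ is a max-extreme point of $S$ if for all $s_1,s_2\in S$ and $\alpha_1,\alpha_2\in\mathbb{R}_{\max}$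 with $\alpha_1\oplus\alpha_2=1$ and $s=\alpha_1s_1\oplus\alpha_2s_2$, it follows that $s=s_1$ or $s=s_2$. A $(0,1)$-matrix is a matrix all of whose entries are $0$ or $1$. *)

theory Defs
  imports "HOL-Analysis.Analysis"
begin

text \<open>The semiring of non-negative reals under maximum and multiplication is rendered as the
  subset of non-negative elements of the type of real numbers; the carrier conditions are stated
  explicitly. Scalars act on matrices by the library's \<open>(*\<^sub>R)\<close>, which is entrywise
  multiplication.\<close>

definition rmax :: "real set" where
  "rmax = {0..}"

definition max_matrices :: "(real^'n^'m) set" where
  "max_matrices = {A. \<forall>i j. A $ i $ j \<in> rmax}"

definition max_plus :: "real^'n^'m \<Rightarrow> real^'n^'m \<Rightarrow> real^'n^'m" (infixl "\<oplus>\<^sub>m" 65) where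
  "A \<oplus>\<^sub>m B = (\<chi> i j. max (A $ i $ j) (B $ i $ j))"

definition max_times :: "real^'k^'m \<Rightarrow> real^'n^'k \<Rightarrow> real^'n^'m" (infixl "\<otimes>\<^sub>m" 70) where
  "A \<otimes>\<^sub>m B = (\<chi> i j. Max (range (\<lambda>k. A $ i $ k * B $ k $ j)))"

text \<open>The all-ones column vector, as a matrix with one column.\<close>

definition ones :: "real^1^'n" where
  "ones = (\<chi> i j. 1)"

definition MDS :: "(real^'n^'n) set" where
  "MDS = {D \<in> max_matrices. D \<otimes>\<^sub>m ones = ones \<and> transpose ones \<otimes>\<^sub>m D = transpose ones}"

definition max_convex :: "(real^'n^'n) set \<Rightarrow> bool" where
  "max_convex S \<longleftrightarrow> S \<subseteq> max_matrices \<and>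
     (\<forall>s\<^sub>1\<in>S. \<forall>s\<^sub>2\<in>S. \<forall>\<alpha>\<^sub>1\<in>rmax. \<forall>\<alpha>\<^sub>2\<in>rmax.
        max \<alpha>\<^sub>1 \<alpha>\<^sub>2 = 1 \<longrightarrow> \<alpha>\<^sub>1 *\<^sub>R s\<^sub>1 \<oplus>\<^sub>m \<alpha>\<^sub>2 *\<^sub>R s\<^sub>2 \<in> S)"

text \<open>Only meaningful for max-convex \<open>S\<close>; see \<open>max_convex_MDS\<close> below for the
  set of max-doubly stochastic matrices.\<close>

definition max_extreme_point :: "(real^'n^'n) set \<Rightarrow> real^'n^'n \<Rightarrow> bool" where
  "max_extreme_point S s \<longleftrightarrow> s \<in> S \<and>
     (\<forall>s\<^sub>1\<in>S. \<forall>s\<^sub>2\<in>S. \<forall>\<alpha>\<^sub>1\<in>rmax. \<forall>\<alpha>\<^sub>2\<in>rmax.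
        max \<alpha>\<^sub>1 \<alpha>\<^sub>2 = 1 \<and> s = \<alpha>\<^sub>1 *\<^sub>R s\<^sub>1 \<oplus>\<^sub>m \<alpha>\<^sub>2 *\<^sub>R s\<^sub>2 \<longrightarrow> s = s\<^sub>1 \<or> s = s\<^sub>2)"

definition zero_one_matrix :: "real^'n^'n \<Rightarrow> bool" where
  "zero_one_matrix A \<longleftrightarrow> (\<forall>i j. A $ i $ j = 0 \<or> A $ i $ j = 1)"

definition change_entry :: "real^'n^'n \<Rightarrow> 'n \<Rightarrow> 'n \<Rightarrow> real \<Rightarrow> real^'n^'n" where
  "change_entry A i j r = (\<chi> k l. if k = i \<and> l = j then r else A $ k $ l)"

lemma MDS_iff:
  "D \<in> MDS \<longleftrightarrow> (\<forall>i j. 0 \<le> D $ i $ j) \<and> (\<forall>i. Max (range (\<lambda>k. D $ i $ k)) = 1)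
     \<and> (\<forall>j. Max (range (\<lambda>k. D $ k $ j)) = 1)"
  by (auto simp: MDS_def max_matrices_def rmax_def max_times_def ones_def transpose_def vec_eq_iff)

lemma Max_range_eq_1_iff:
  fixes f :: "'n::finite \<Rightarrow> real"
  shows "Max (range f) = 1 \<longleftrightarrow> (\<forall>k. f k \<le> 1) \<and> (\<exists>k. f k = 1)"
  by (subst Max_eq_iff) (auto intro: sym)

lemma max_convex_MDS: "max_convex (MDS :: (real^'n^'n) set)"
proof -
  have *: "\<alpha> *\<^sub>R s \<oplus>\<^sub>m \<beta> *\<^sub>R t \<in> MDS"
    if "s \<in> MDS" "t \<in> MDS" "0 \<le> \<alpha>" "0 \<le> \<beta>" "max \<alpha> \<beta> = 1"
    for s t :: "real^'n^'n" and \<alpha> \<beta>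
  proof -
    have le: "\<alpha> \<le> 1" "\<beta> \<le> 1" and one: "\<alpha> = 1 \<or> \<beta> = 1"
      using that(5) by (auto simp: max_def split: if_splits)
    have st: "0 \<le> s $ i $ j" "s $ i $ j \<le> 1" "0 \<le> t $ i $ j" "t $ i $ j \<le> 1" for i j
      using that(1,2) by (auto simp: MDS_iff Max_range_eq_1_iff)
    have b: "\<alpha> * s $ i $ j \<le> 1" "\<beta> * t $ i $ j \<le> 1" for i j
      using st le that(3,4) by (auto intro: mult_le_one)
    show ?thesis
      using one
    proof
      assume "\<alpha> = 1"
      then show ?thesis
        using that(1) st b unfolding MDS_iff Max_range_eq_1_iff max_plus_def
        by (auto simp: le_max_iff_disj) (metis max.absorb1)+
    next
      assume "\<beta> = 1"
      then show ?thesis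
        using that(2) st b unfolding MDS_iff Max_range_eq_1_iff max_plus_def
        by (auto simp: le_max_iff_disj) (metis max.absorb2)+
    qed
  qed
  show ?thesis
    unfolding max_convex_def using * by (auto simp: rmax_def) (auto simp: MDS_def)
qed

end

theory Submission
  imports Defs
begin

text \<open>The weights of a max-convex combination satisfy \<open>max \<alpha>\<^sub>1 \<alpha>\<^sub>2 = 1\<close>, so one of the two terms
  enters unscaled.

  Extremality forces entries in \<open>{0, 1}\<close>, because an entry \<open>e\<close> strictly between \<open>0\<close> and \<open>1\<close> can be
  split: lower it to \<open>0\<close> in one matrix, raise it to \<open>1\<close> in another, and recover \<open>E\<close> with the weights
  \<open>1\<close> and \<open>e\<close>. Both matrices are max-doubly stochastic since an entry below \<open>1\<close> never witnesses a
  row or column maximum (\<open>change_entry_below_one_in_MDS\<close>). If two different ones of \<open>E\<close> can be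
  lowered, then \<open>E\<close> is the entrywise maximum of the two lowered matrices, each lowered matrix
  restoring the entry that the other one has lost, and \<open>E\<close> is not extreme.

  Conversely, let \<open>E\<close> be a \<open>(0,1)\<close>-matrix that is a max-convex combination of \<open>s\<^sub>1\<close> and \<open>s\<^sub>2\<close>. If a
  weight is below \<open>1\<close>, its term cannot produce any one of \<open>E\<close>, so the other matrix equals \<open>E\<close>.
  If both weights are \<open>1\<close> and both matrices differ from \<open>E\<close>, then each of them is below \<open>1\<close> at some
  one of \<open>E\<close>. Membership in the set of max-doubly stochastic matrices passes to matrices in between
  (\<open>MDS_between\<close>), so that one of \<open>E\<close> can be lowered. The two positions found in this way
  are different, because the maximum of \<open>s\<^sub>1\<close> and \<open>s\<^sub>2\<close> is \<open>1\<close> at each of them.\<close>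

lemma MDS_iff_entries:
  fixes D :: "real^'n^'n"
  shows "D \<in> MDS \<longleftrightarrow> (\<forall>i j. 0 \<le> D $ i $ j \<and> D $ i $ j \<le> 1)
    \<and> (\<forall>i. \<exists>j. D $ i $ j = 1) \<and> (\<forall>j. \<exists>i. D $ i $ j = 1)"
  unfolding MDS_iff Max_range_eq_1_iff by blast

text \<open>The lower matrix supplies the ones in every row and column, the upper matrix the bound \<open>1\<close>.\<close>

lemma MDS_between:
  fixes S D E :: "real^'n^'n"
  assumes "S \<in> MDS" "E \<in> MDS"
    and "\<And>i j. S $ i $ j \<le> D $ i $ j" "\<And>i j. D $ i $ j \<le> E $ i $ j"
  shows "D \<in> MDS"
proof -
  have bounds: "0 \<le> D $ i $ j \<and> D $ i $ j \<le> 1" for i j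
    using assms by (meson MDS_iff_entries order_trans)
  have "D $ i $ j = 1" if "S $ i $ j = 1" for i j
    using bounds[of i j] assms(3)[of i j] that by simp
  then show ?thesis
    using assms(1) bounds unfolding MDS_iff_entries by blast
qed

text \<open>Only ones witness that a row or column maximum is \<open>1\<close>, so an entry below \<open>1\<close> can be set to any
  number in \<open>[0, 1]\<close>. Both extreme choices \<open>0\<close> and \<open>1\<close> serve to split a fractional entry.\<close>

lemma change_entry_below_one_in_MDS:
  fixes E :: "real^'n^'n"
  assumes "E \<in> MDS" "E $ i $ j < 1" "0 \<le> r" "r \<le> 1"
  shows "change_entry E i j r \<in> MDS"
proof -
  have "change_entry E i j r $ k $ l = 1" if "E $ k $ l = 1" for k l
    using that assms(2) by (auto simp: change_entry_def)
  moreover have "0 \<le> change_entry E i j r $ k $ l \<and> change_entry E i j r $ k $ l \<le> 1" for k l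
    using assms by (auto simp: change_entry_def MDS_iff_entries)
  ultimately show ?thesis
    using assms(1) unfolding MDS_iff_entries by blast
qed

text \<open>The symmetry between the two terms allows the first weight to be the one that equals \<open>1\<close>.\<close>

lemma max_extreme_pointD:
  assumes "max_extreme_point S s" "s\<^sub>1 \<in> S" "s\<^sub>2 \<in> S" "0 \<le> \<alpha>" "\<alpha> \<le> 1"
    and "s = s\<^sub>1 \<oplus>\<^sub>m \<alpha> *\<^sub>R s\<^sub>2"
  shows "s = s\<^sub>1 \<or> s = s\<^sub>2"
proof -
  have "1 \<in> rmax" "\<alpha> \<in> rmax" "max 1 \<alpha> = 1" "s = 1 *\<^sub>R s\<^sub>1 \<oplus>\<^sub>m \<alpha> *\<^sub>R s\<^sub>2"
    using assms by (auto simp: rmax_def)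
  then show ?thesis
    using assms(1-3) unfolding max_extreme_point_def by blast
qed

lemma max_plus_commute: "A \<oplus>\<^sub>m B = B \<oplus>\<^sub>m A"
  by (simp add: max_plus_def max.commute)

lemma change_entry_neq:
  assumes "r \<noteq> E $ i $ j"
  shows "E \<noteq> change_entry E i j r"
proof
  assume "E = change_entry E i j r"
  then have "E $ i $ j = change_entry E i j r $ i $ j"
    by simp
  with assms show False
    by (simp add: change_entry_def)
qed

lemma max_extreme_MDS_imp_zero_one:
  fixes E :: "real^'n^'n"
  assumes ext: "max_extreme_point MDS E"
  shows "zero_one_matrix E"
proof (rule ccontr)
  assume "\<not> zero_one_matrix E"
  then obtain i j where ne: "E $ i $ j \<noteq> 0" "E $ i $ j \<noteq> 1"
    by (auto simp: zero_one_matrix_def)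
  have E: "E \<in> MDS"
    using ext by (simp add: max_extreme_point_def)
  have bounds: "0 \<le> E $ k $ l" "E $ k $ l \<le> 1" for k l
    using E by (auto simp: MDS_iff_entries)
  let ?e = "E $ i $ j"
  have e: "0 < ?e" "?e < 1"
    using ne bounds[of i j] by auto
  \<comment> \<open>Away from \<open>(i, j)\<close> the second term is \<open>e\<close> times an entry of \<open>E\<close>, hence dominated by the first.\<close>
  have "?e * E $ k $ l \<le> E $ k $ l" for k l
    using bounds by (simp add: mult_left_le_one_le)
  then have "E = change_entry E i j 0 \<oplus>\<^sub>m ?e *\<^sub>R change_entry E i j 1"
    using e by (auto simp: vec_eq_iff max_plus_def change_entry_def max.absorb1)
  moreover have "change_entry E i j 0 \<in> MDS" "change_entry E i j 1 \<in> MDS"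
    using E e by (auto intro: change_entry_below_one_in_MDS)
  ultimately have "E = change_entry E i j 0 \<or> E = change_entry E i j 1"
    using max_extreme_pointD[OF ext] e by (meson less_imp_le)
  then show False
    using ne change_entry_neq by metis
qed

text \<open>Matrices obtained by lowering two different ones repair each other under the entrywise maximum.\<close>

lemma max_extreme_imp_lowerable_one_unique:
  fixes E :: "real^'n^'n"
  assumes ext: "max_extreme_point S E"
  shows "\<exists>\<^sub>\<le>\<^sub>1 (i, j). E $ i $ j = 1 \<and> (\<exists>r. 0 \<le> r \<and> r < 1 \<and> change_entry E i j r \<in> S)"
proof -
  have "(i, j) = (k, l)"
    if ij: "E $ i $ j = 1" "r < 1" "change_entry E i j r \<in> S"
      and kl: "E $ k $ l = 1" "q < 1" "change_entry E k l q \<in> S" for i j k l r q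
  proof (rule ccontr)
    assume "(i, j) \<noteq> (k, l)"
    then have "E = change_entry E i j r \<oplus>\<^sub>m 1 *\<^sub>R change_entry E k l q"
      using ij kl by (auto simp: vec_eq_iff max_plus_def change_entry_def)
    then have "E = change_entry E i j r \<or> E = change_entry E k l q"
      using max_extreme_pointD[OF ext ij(3) kl(3), of 1] by simp
    then show False
      using ij kl change_entry_neq by (metis less_irrefl)
  qed
  then show ?thesis
    unfolding Uniq_def by auto
qed

text \<open>At any position where \<open>S\<close> and \<open>E\<close> differ, \<open>E\<close> has a one, and lowering this single entry to its
  value in \<open>S\<close> gives a matrix between \<open>S\<close> and \<open>E\<close>.\<close>

lemma lowerable_one_if_below:
  fixes E S :: "real^'n^'n"
  assumes "zero_one_matrix E" "E \<in> MDS" "S \<in> MDS"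
    and le: "\<And>i j. S $ i $ j \<le> E $ i $ j" and "E \<noteq> S"
  obtains i j where "E $ i $ j = 1" "S $ i $ j < 1" "0 \<le> S $ i $ j"
    "change_entry E i j (S $ i $ j) \<in> MDS"
proof -
  obtain i j where ne: "S $ i $ j \<noteq> E $ i $ j"
    using \<open>E \<noteq> S\<close> by (metis vec_eq_iff)
  have pos: "0 \<le> S $ i $ j"
    using assms(3) by (simp add: MDS_iff_entries)
  moreover have "E $ i $ j = 0 \<or> E $ i $ j = 1"
    using assms(1) by (simp add: zero_one_matrix_def)
  ultimately have one: "E $ i $ j = 1" and less: "S $ i $ j < 1"
    using ne le[of i j] by auto
  have "change_entry E i j (S $ i $ j) \<in> MDS"
    using assms(3,2) by (rule MDS_between) (auto simp: change_entry_def le)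
  with one less pos show ?thesis
    using that by blast
qed

text \<open>If both terms differ from \<open>E\<close>, each of them points to a one of \<open>E\<close> that can be lowered. By
  uniqueness these ones share their position, but there neither term attains the value \<open>1\<close>.\<close>

lemma max_combination_eq_one_term:
  fixes E :: "real^'n^'n"
  assumes E: "E \<in> MDS" and zero_one: "zero_one_matrix E"
    and uniq: "\<exists>\<^sub>\<le>\<^sub>1 (i, j). E $ i $ j = 1 \<and> (\<exists>r. 0 \<le> r \<and> r < 1 \<and> change_entry E i j r \<in> MDS)"
    and S: "S \<in> MDS" and T: "T \<in> MDS" and \<alpha>: "0 \<le> \<alpha>" "\<alpha> \<le> 1"
    and comb: "E = S \<oplus>\<^sub>m \<alpha> *\<^sub>R T"
  shows "E = S \<or> E = T"
proof (rule ccontr)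
  assume "\<not> (E = S \<or> E = T)"
  then have ne: "E \<noteq> S" "E \<noteq> T"
    by auto
  have entry: "E $ i $ j = max (S $ i $ j) (\<alpha> * T $ i $ j)" for i j
    by (simp add: comb max_plus_def)
  obtain i j where ij: "E $ i $ j = 1" "S $ i $ j < 1" "0 \<le> S $ i $ j"
      "change_entry E i j (S $ i $ j) \<in> MDS"
    using lowerable_one_if_below[OF zero_one E S _ ne(1)] entry by (metis max.cobounded1)
  \<comment> \<open>The one at \<open>(i, j)\<close> must come from the scaled term, and this leaves no room for scaling.\<close>
  have "\<alpha> * T $ i $ j = 1"
    using entry[of i j] ij by (auto simp: max_def split: if_splits)
  moreover have "\<alpha> * T $ i $ j \<le> \<alpha>"
    using T \<alpha> by (simp add: MDS_iff_entries mult_left_le)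
  ultimately have "\<alpha> = 1" and Tij: "T $ i $ j = 1"
    using \<alpha> by auto
  then have "T $ k $ l \<le> E $ k $ l" for k l
    by (simp add: entry)
  then obtain k l where kl: "E $ k $ l = 1" "T $ k $ l < 1" "0 \<le> T $ k $ l"
      "change_entry E k l (T $ k $ l) \<in> MDS"
    using lowerable_one_if_below[OF zero_one E T _ ne(2)] by metis
  have "(i, j) = (k, l)"
    using uniq ij kl by (intro Uniq_D[OF uniq]) auto
  with Tij kl(2) show False
    by simp
qed

theorem theorem2p18:
  fixes E :: "real^'n^'n"
  assumes "E \<in> MDS"
  shows "max_extreme_point MDS E \<longleftrightarrow>
    zero_one_matrix E \<and>
    (\<exists>\<^sub>\<le>\<^sub>1 (i, j). E $ i $ j = 1 \<and> (\<exists>r. 0 \<le> r \<and> r < 1 \<and> change_entry E i j r \<in> MDS))"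
    (is "_ \<longleftrightarrow> _ \<and> ?unique")
proof
  assume "max_extreme_point MDS E"
  then show "zero_one_matrix E \<and> ?unique"
    using max_extreme_MDS_imp_zero_one max_extreme_imp_lowerable_one_unique by blast
next
  assume R: "zero_one_matrix E \<and> ?unique"
  note one_term = max_combination_eq_one_term[OF assms conjunct1[OF R] conjunct2[OF R]]
  have "E = S \<or> E = T"
    if "S \<in> MDS" "T \<in> MDS" "0 \<le> \<alpha>" "0 \<le> \<beta>" "max \<alpha> \<beta> = 1" "E = \<alpha> *\<^sub>R S \<oplus>\<^sub>m \<beta> *\<^sub>R T"
    for S T :: "real^'n^'n" and \<alpha> \<beta>
  proof (cases "\<alpha> = 1")
    case True
    then show ?thesis
      using one_term[of S T \<beta>] that by simp
  next
    case False
    then have "\<beta> = 1" "\<alpha> \<le> 1"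
      using that(5) by (auto simp: max_def split: if_splits)
    then show ?thesis
      using one_term[of T S \<alpha>] that max_plus_commute[of "\<alpha> *\<^sub>R S"] by auto
  qed
  then show "max_extreme_point MDS E"
    using assms by (auto simp: max_extreme_point_def rmax_def)
qed

end
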